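(* $$3\ \ge\ \limsup_{v\to\infty}\frac{T(v)}{v}\ \ge\ \liminf_{v\to\infty}\frac{T(v)}{v}\ \ge\ \frac{20}{7}.$$
   Context: A symmetric configuration $v_3$ is a finite incidence structure with $v$ points and $v$ blocks such that each block contains exactly $3$ points, each point is contained in exactly $3$ blocks, and any pair of distinct points is contained in at most one block. It is connected (indecomposable) if it is not the union of two configurations on disjoint point sets. All configurations here are assumed to be connected. A triangle in a configuration is a set of three distinct blocks of the form $\{a,b,f\},\{a,c,e\},\{b,c,d\}$, where $a,b,c,d,e,f$ are six distinct points. For a connected symmetric configuration $C$ with parameters $v_3$, $t(C)$ denotes the number of triangles in $C$. For $v\ge 7$, $T(v)$ denotes the maximum value of $t(C)$ over all connected symmetric configurations $C$ with parameters $v_3$. *)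

theory Defs
  imports "HOL-Library.Extended_Real"
begin

(* Blocks are sets of points: two blocks with the same three points would
   violate the condition on pairs, so no repeated blocks are lost. *)
definition symmetric_configuration :: "nat \<Rightarrow> 'a set \<Rightarrow> 'a set set \<Rightarrow> bool" where
  "symmetric_configuration v P B \<longleftrightarrow>
     finite P \<and> card P = v \<and>
     B \<subseteq> Pow P \<and> card B = v \<and>
     (\<forall>b\<in>B. card b = 3) \<and>
     (\<forall>p\<in>P. card {b \<in> B. p \<in> b} = 3) \<and>
     (\<forall>p\<in>P. \<forall>q\<in>P. p \<noteq> q \<longrightarrow> card {b \<in> B. p \<in> b \<and> q \<in> b} \<le> 1)"

(* The parts of a decomposition are required to be nonempty (0 < v1, 0 < v2);
   otherwise the empty structure would make everything decomposable. *)
definition decomposable :: "'a set \<Rightarrow> 'a set set \<Rightarrow> bool" where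
  "decomposable P B \<longleftrightarrow>
     (\<exists>v1 P1 B1 v2 P2 B2.
        0 < v1 \<and> symmetric_configuration v1 P1 B1 \<and>
        0 < v2 \<and> symmetric_configuration v2 P2 B2 \<and>
        P1 \<inter> P2 = {} \<and> P = P1 \<union> P2 \<and> B = B1 \<union> B2)"

definition connected_symmetric_configuration :: "nat \<Rightarrow> 'a set \<Rightarrow> 'a set set \<Rightarrow> bool" where
  "connected_symmetric_configuration v P B \<longleftrightarrow>
     symmetric_configuration v P B \<and> \<not> decomposable P B"

definition triangles :: "'a set set \<Rightarrow> 'a set set set" where
  "triangles B =
     {S. S \<subseteq> B \<and>
         (\<exists>a b c d e f. distinct [a, b, c, d, e, f] \<and>
            S = {{a, b, f}, {a, c, e}, {b, c, d}})}"

definition num_triangles :: "'a set set \<Rightarrow> nat" where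
  "num_triangles B = card (triangles B)"

(* Up to isomorphism every finite configuration has its points in nat.
   Max is meaningful for v >= 7, where connected configurations exist; for
   smaller v there are none with v >= 1, and the value has no significance. *)
definition max_triangles :: "nat \<Rightarrow> nat" where
  "max_triangles v =
     Max {num_triangles B | (P :: nat set) B. connected_symmetric_configuration v P B}"

end

theory Submission
  imports Defs
begin

text \<open>
  Lower bound: in two configurations on disjoint point sets choose flags \<open>(x1, L1)\<close>, \<open>(x2, L2)\<close>
  and exchange \<open>x1\<close> and \<open>x2\<close> in the two blocks. A Fano plane treated in this way keeps 20 of its
  28 triangles and brings 7 points. A chain of Fano planes, with up to six copies of the
  Moebius-Kantor configuration added to reach every residue modulo 7, therefore has
  \<open>20 v / 7 - O(1)\<close> triangles.

  Upper bound: for a block \<open>b\<close> and a point \<open>s\<close> off \<open>b\<close> let \<open>k(s) \<le> 3\<close> be the number of blocks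
  through \<open>s\<close> that meet \<open>b\<close>. The \<open>k(s)\<close> add up to 12, and \<open>b\<close> lies in the sum of the \<open>k(s)\<close> choose 2
  triangles. This exceeds 9 only if the nonzero \<open>k(s)\<close> are \<open>3,3,3,3\<close> (then \<open>b\<close> lies in a component
  that is a Fano plane) or \<open>3,3,3,2,1\<close> (ten triangles). In the second case the block meeting \<open>b\<close>
  through the point with \<open>k(s) = 1\<close> lies in at most four triangles and absorbs the excess, so that
  the average over all blocks is at most 9.
\<close>

section \<open>Configurations\<close>

lemma symmetric_configurationD:
  assumes "symmetric_configuration v P B"
  shows "finite P" "card P = v" "B \<subseteq> Pow P" "card B = v" "finite B"
    and "\<And>b. b \<in> B \<Longrightarrow> card b = 3" "\<And>b. b \<in> B \<Longrightarrow> finite b"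
    and "\<And>b. b \<in> B \<Longrightarrow> b \<subseteq> P"
    and "\<And>p. p \<in> P \<Longrightarrow> card {b \<in> B. p \<in> b} = 3"
    and "\<And>p q b c. \<lbrakk>b \<in> B; c \<in> B; p \<in> b; q \<in> b; p \<in> c; q \<in> c; p \<noteq> q\<rbrakk> \<Longrightarrow> b = c"
proof -
  show fP: "finite P" and "card P = v" and BP: "B \<subseteq> Pow P" and "card B = v"
    and "\<And>b. b \<in> B \<Longrightarrow> card b = 3"
    and "\<And>p. p \<in> P \<Longrightarrow> card {b \<in> B. p \<in> b} = 3"
    using assms unfolding symmetric_configuration_def by blast+
  show fB: "finite B"
    using fP BP by (meson finite_Pow_iff finite_subset)
  show sub: "\<And>b. b \<in> B \<Longrightarrow> b \<subseteq> P" using BP by blast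
  then show "\<And>b. b \<in> B \<Longrightarrow> finite b" using fP finite_subset by blast
  fix p q b c
  assume *: "b \<in> B" "c \<in> B" "p \<in> b" "q \<in> b" "p \<in> c" "q \<in> c" "p \<noteq> q"
  then have "card {b \<in> B. p \<in> b \<and> q \<in> b} \<le> 1"
    using assms sub unfolding symmetric_configuration_def by blast
  moreover have "finite {b \<in> B. p \<in> b \<and> q \<in> b}" using fB by simp
  ultimately show "b = c" using * by (auto simp: card_le_Suc0_iff_eq)
qed

lemma flag_double_count:
  assumes "finite P" "finite B" "B \<subseteq> Pow P" "\<And>b. b \<in> B \<Longrightarrow> card b = k"
    and "\<And>p. p \<in> P \<Longrightarrow> card {b \<in> B. p \<in> b} = k"
  shows "k * card B = k * card P"
proof -
  have "k * card B = (\<Sum>b\<in>B. card b)" using assms(4) by simp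
  also have "\<dots> = (\<Sum>b\<in>B. card {p \<in> P. p \<in> b})"
    using assms(3) by (intro sum.cong refl arg_cong[where f = card]) auto
  also have "\<dots> = (\<Sum>p\<in>P. card {b \<in> B. p \<in> b})"
    using assms(1,2) by (intro sum_multicount_gen) auto
  also have "\<dots> = k * card P" using assms(5) by simp
  finally show ?thesis .
qed

text \<open>The number of blocks need not be supplied: counting flags in two ways gives
  \<open>3 * card B = 3 * card P\<close>.\<close>

lemma symmetric_configurationI:
  assumes "finite P" "card P = v" "B \<subseteq> Pow P" "\<And>b. b \<in> B \<Longrightarrow> card b = 3"
    and "\<And>p. p \<in> P \<Longrightarrow> card {b \<in> B. p \<in> b} = 3"
    and "\<And>p q b c. \<lbrakk>b \<in> B; c \<in> B; p \<in> b; q \<in> b; p \<in> c; q \<in> c; p \<noteq> q\<rbrakk> \<Longrightarrow> b = c"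
  shows "symmetric_configuration v P B"
proof -
  have fB: "finite B" using assms(1,3) by (meson finite_Pow_iff finite_subset)
  have "card B = v"
    using flag_double_count[of P B 3] assms fB by simp
  moreover have "card {b \<in> B. p \<in> b \<and> q \<in> b} \<le> 1" if "p \<noteq> q" for p q
  proof -
    have "finite {b \<in> B. p \<in> b \<and> q \<in> b}" using fB by simp
    then show ?thesis using assms(6) that by (auto simp: card_le_Suc0_iff_eq)
  qed
  ultimately show ?thesis
    using assms unfolding symmetric_configuration_def by blast
qed

lemma symmetric_configuration_image:
  assumes "symmetric_configuration v P B" "inj g"
  shows "symmetric_configuration v (g ` P) ((`) g ` B)"
proof -
  note D = symmetric_configurationD[OF assms(1)]
  have injI: "inj ((`) g)" using assms(2) by (simp add: inj_image_eq_iff inj_def)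
  show ?thesis
  proof (rule symmetric_configurationI)
    show "finite (g ` P)" using D by simp
    show "card (g ` P) = v" using D assms(2) by (metis card_image inj_on_subset subset_UNIV)
    show "(`) g ` B \<subseteq> Pow (g ` P)" using D by blast
    show "card b = 3" if "b \<in> (`) g ` B" for b
      using that D(6) assms(2) by (auto simp: card_image inj_on_def)
    show "card {b \<in> (`) g ` B. p \<in> b} = 3" if p: "p \<in> g ` P" for p
    proof -
      obtain p' where p': "p = g p'" "p' \<in> P" using p by blast
      have "{b \<in> (`) g ` B. p \<in> b} = (`) g ` {b \<in> B. p' \<in> b}"
        using assms(2) p' by (auto simp: inj_image_mem_iff inj_eq)
      moreover have "card \<dots> = card {b \<in> B. p' \<in> b}"
        using injI by (meson card_image inj_on_subset subset_UNIV)
      ultimately show ?thesis using D p' by simp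
    qed
    show "b = c" if h: "b \<in> (`) g ` B" "c \<in> (`) g ` B" "p \<in> b" "q \<in> b" "p \<in> c" "q \<in> c" "p \<noteq> q"
      for p q b c
    proof -
      obtain b' c' p' q' where "b = g ` b'" "b' \<in> B" "c = g ` c'" "c' \<in> B" "p = g p'" "q = g q'"
        using h by blast
      then show ?thesis using h D(10)[of b' c' p' q'] assms(2)
        by (simp add: inj_image_mem_iff) blast
    qed
  qed
qed

text \<open>Connectivity is phrased by closure instead of paths. The family \<open>C\<close> need
  not be all blocks, so the notion can be used after a block has been removed, and blocks of
  \<open>C\<close> may leave \<open>P\<close>, so it passes to larger families.\<close>

definition linked :: "'a set \<Rightarrow> 'a set set \<Rightarrow> bool" where
  "linked P C \<longleftrightarrow> (\<forall>Q. Q \<inter> P \<noteq> {} \<longrightarrow> (\<forall>b\<in>C. b \<inter> Q \<noteq> {} \<longrightarrow> b \<subseteq> Q) \<longrightarrow> P \<subseteq> Q)"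

lemma linkedD:
  assumes "linked P C" "p \<in> P" "p \<in> Q" "\<And>b. \<lbrakk>b \<in> C; b \<inter> Q \<noteq> {}\<rbrakk> \<Longrightarrow> b \<subseteq> Q"
  shows "P \<subseteq> Q"
  using assms unfolding linked_def by (metis disjoint_iff)

text \<open>A closed set that meets one of the two parts swallows it, then the connecting block
  \<open>l\<close>, and through \<open>l\<close> the other part.\<close>

lemma linked_Un:
  assumes "linked P C" "linked Q D" "l \<in> E" "l \<inter> P \<noteq> {}" "l \<inter> Q \<noteq> {}" "C \<subseteq> E" "D \<subseteq> E"
  shows "linked (P \<union> Q) E"
  unfolding linked_def
proof (intro allI impI)
  fix X assume X: "X \<inter> (P \<union> Q) \<noteq> {}" "\<forall>b\<in>E. b \<inter> X \<noteq> {} \<longrightarrow> b \<subseteq> X"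
  have P: "P \<subseteq> X" if "p \<in> P" "p \<in> X" for p
    by (rule linkedD[OF assms(1) that]) (use X(2) assms(6) in blast)
  have Q: "Q \<subseteq> X" if "p \<in> Q" "p \<in> X" for p
    by (rule linkedD[OF assms(2) that]) (use X(2) assms(7) in blast)
  have "l \<inter> X \<noteq> {}" using X(1) P Q assms(4,5) by blast
  then have "l \<subseteq> X" using X(2) assms(3) by blast
  then have "P \<subseteq> X" "Q \<subseteq> X" using P Q assms(4,5) by blast+
  then show "P \<union> Q \<subseteq> X" by blast
qed

lemma linked_image:
  assumes "linked P C"
  shows "linked (g ` P) ((`) g ` C)"
  unfolding linked_def
proof (intro allI impI)
  fix Q assume Q: "Q \<inter> g ` P \<noteq> {}" "\<forall>b\<in>(`) g ` C. b \<inter> Q \<noteq> {} \<longrightarrow> b \<subseteq> Q"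
  then obtain p where p: "p \<in> P" "p \<in> g -` Q" by blast
  have "b \<subseteq> g -` Q" if b: "b \<in> C" "b \<inter> g -` Q \<noteq> {}" for b
  proof -
    have "g ` b \<in> (`) g ` C" "g ` b \<inter> Q \<noteq> {}" using b by blast+
    then have "g ` b \<subseteq> Q" using Q(2) by blast
    then show ?thesis by blast
  qed
  then have "P \<subseteq> g -` Q" by (rule linkedD[OF assms p])
  then show "g ` P \<subseteq> Q" by blast
qed

text \<open>One part of a decomposition would be a closed set: a block that meets \<open>P1\<close>
  cannot come from \<open>B2\<close>, hence lies in \<open>P1\<close>.\<close>

lemma linked_imp_not_decomposable:
  assumes "linked P B"
  shows "\<not> decomposable P B"
proof
  assume "decomposable P B"
  then obtain v1 P1 B1 v2 P2 B2 where
    h: "0 < v1" "symmetric_configuration v1 P1 B1" "0 < v2" "symmetric_configuration v2 P2 B2"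
       "P1 \<inter> P2 = {}" "P = P1 \<union> P2" "B = B1 \<union> B2"
    unfolding decomposable_def by blast
  have "P1 \<noteq> {}" "P2 \<noteq> {}"
    using h(1,3) symmetric_configurationD(2)[OF h(2)] symmetric_configurationD(2)[OF h(4)] by auto
  moreover have "b \<subseteq> P1" if "b \<in> B" "b \<inter> P1 \<noteq> {}" for b
    using that h(5,7) symmetric_configurationD(3)[OF h(2)] symmetric_configurationD(3)[OF h(4)]
    by blast
  ultimately have "P \<subseteq> P1"
    using linkedD[OF assms, of _ P1] h(6) by blast
  then show False using h(5,6) \<open>P2 \<noteq> {}\<close> by blast
qed

section \<open>Triangles of subfamilies and of injective images\<close>

lemma triangles_memD:
  assumes "S \<in> triangles B"
  shows "S \<subseteq> B" "S \<noteq> {}"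
proof -
  have "S \<subseteq> B \<and> (\<exists>a b c d e f. distinct [a, b, c, d, e, f] \<and> S = {{a, b, f}, {a, c, e}, {b, c, d}})"
    using assms by (simp only: triangles_def mem_Collect_eq)
  then show "S \<subseteq> B" "S \<noteq> {}" by (simp, elim conjE exE, simp)
qed

lemma triangles_finite: "finite B \<Longrightarrow> finite (triangles B)"
  by (rule finite_subset[of _ "Pow B"]) (auto dest: triangles_memD(1))

lemma triangles_mono: "B \<subseteq> C \<Longrightarrow> triangles B \<subseteq> triangles C"
  unfolding triangles_def by (rule Collect_mono) (rule impI, erule conjE, rule conjI, erule order_trans, assumption+)

lemma triangles_disjoint:
  assumes "B \<inter> C = {}"
  shows "triangles B \<inter> triangles C = {}"
proof -
  have False if "S \<in> triangles B" "S \<in> triangles C" for S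
    using triangles_memD[OF that(1)] triangles_memD(1)[OF that(2)] assms by blast
  then show ?thesis by blast
qed

lemma triangles_image_subset:
  assumes "inj_on g P" "B \<subseteq> Pow P"
  shows "(`) ((`) g) ` triangles B \<subseteq> triangles ((`) g ` B)"
proof
  fix S assume "S \<in> (`) ((`) g) ` triangles B"
  then obtain S' where S': "S' \<in> triangles B" "S = (`) g ` S'" by (rule imageE)
  obtain a b c d e f where abc: "distinct [a,b,c,d,e,f]" "S' = {{a, b, f}, {a, c, e}, {b, c, d}}"
    and "S' \<subseteq> B"
    using S'(1) unfolding triangles_def mem_Collect_eq by (elim conjE exE) (rule that)
  then have h: "distinct [a,b,c,d,e,f]" "{{a, b, f}, {a, c, e}, {b, c, d}} \<subseteq> B"
      "S = (`) g ` {{a, b, f}, {a, c, e}, {b, c, d}}"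
    using S' by simp_all
  have "\<Union> {{a, b, f}, {a, c, e}, {b, c, d}} \<subseteq> P" using h(2) assms(2) by blast
  then have "set [a,b,c,d,e,f] \<subseteq> P" by simp
  then have "inj_on g (set [a,b,c,d,e,f])" by (rule inj_on_subset[OF assms(1)])
  then have "distinct (map g [a,b,c,d,e,f])" by (rule distinct_map[THEN iffD2, OF conjI[OF h(1)]])
  then have "distinct [g a,g b,g c,g d,g e,g f]" by simp
  moreover have "S = {{g a, g b, g f}, {g a, g c, g e}, {g b, g c, g d}}" using h(3) by simp
  moreover have "S \<subseteq> (`) g ` B" unfolding h(3) by (rule image_mono[OF h(2)])
  ultimately show "S \<in> triangles ((`) g ` B)"
    unfolding triangles_def mem_Collect_eq by (intro conjI exI)
qed

lemma card_triangles_image: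
  assumes "inj_on g P" "B \<subseteq> Pow P" "finite B"
  shows "card (triangles B) \<le> card (triangles ((`) g ` B))"
proof -
  have "inj_on ((`) g) (Pow P)" using assms(1) by (simp add: inj_on_image_Pow)
  then have "inj_on ((`) ((`) g)) (Pow (Pow P))" by (rule inj_on_image_Pow)
  moreover have "triangles B \<subseteq> Pow (Pow P)"
  proof
    fix S assume "S \<in> triangles B"
    then show "S \<in> Pow (Pow P)" using triangles_memD(1) assms(2) by blast
  qed
  ultimately have "inj_on ((`) ((`) g)) (triangles B)" by (rule inj_on_subset)
  then have "card (triangles B) = card ((`) ((`) g) ` triangles B)" by (simp add: card_image)
  also have "\<dots> \<le> card (triangles ((`) g ` B))"
    by (intro card_mono triangles_finite triangles_image_subset[OF assms(1,2)])
      (use assms(3) in simp)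
  finally show ?thesis .
qed

section \<open>Switching two flags\<close>

text \<open>The point \<open>x1\<close> loses \<open>L1\<close> and gains the second new block; the
  other points of \<open>L1\<close> lose \<open>L1\<close> and gain the first; the remaining points
  of \<open>P1\<close> keep their blocks. Points of \<open>P2\<close> follow by exchanging the roles
  of the two configurations.\<close>

lemma glue_degree:
  fixes x1 x2 :: 'a
  assumes S1: "symmetric_configuration v1 P1 B1" and L1: "L1 \<in> B1" "x1 \<in> L1"
    and S2: "symmetric_configuration v2 P2 B2" and L2: "L2 \<in> B2" "x2 \<in> L2"
    and dis: "P1 \<inter> P2 = {}" and p: "p \<in> P1"
  shows "card {b \<in> (B1 - {L1}) \<union> (B2 - {L2}) \<union> {insert x2 (L1 - {x1}), insert x1 (L2 - {x2})}.
               p \<in> b} = 3" (is "card {b \<in> ?B. p \<in> b} = 3")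
proof -
  define K1 K2 where K: "K1 = insert x2 (L1 - {x1})" "K2 = insert x1 (L2 - {x2})"
  note D1 = symmetric_configurationD[OF S1] and D2 = symmetric_configurationD[OF S2]
  have sub: "L1 \<subseteq> P1" "L2 \<subseteq> P2" using D1(8) D2(8) L1 L2 by auto
  then have x: "x1 \<in> P1" "x2 \<in> P2" "x1 \<notin> P2" "x2 \<notin> P1" using L1 L2 dis by auto
  have "card (L2 - {x2}) = 2" using D2(6)[OF L2(1)] L2(2) by simp
  then have "L2 - {x2} \<noteq> {}" by fastforce
  then have new: "K1 \<notin> B1" "K2 \<notin> B1" using D1(8) sub x dis unfolding K by blast+
  have K2L: "x2 \<in> K1" "x2 \<notin> K2" "x1 \<notin> K1" "x1 \<in> K2" using x unfolding K by auto
  have pB2: "p \<notin> b" if "b \<in> B2" for b using D2(8)[OF that] dis p by blast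
  let ?A = "{b \<in> B1. p \<in> b}"
  have A: "card ?A = 3" "finite ?A" using D1(5,9) p by simp_all
  have swap: "card (insert N (?A - {L1})) = 3" if "L1 \<in> ?A" "N \<notin> B1" for N
    using A that by (subst card_insert_disjoint) auto
  consider "p = x1" | "p \<noteq> x1" "p \<in> L1" | "p \<noteq> x1" "p \<notin> L1" by blast
  then show ?thesis
  proof cases
    case 1
    then have "{b \<in> ?B. p \<in> b} = insert K2 (?A - {L1})"
      using pB2 K2L unfolding K[symmetric] by blast
    then show ?thesis using swap[of K2] new L1 1 by simp
  next
    case 2
    then have "p \<in> K1" "p \<notin> K2" using sub dis p unfolding K by auto
    then have "{b \<in> ?B. p \<in> b} = insert K1 (?A - {L1})"
      using pB2 unfolding K[symmetric] by blast
    then show ?thesis using swap[of K1] new L1 2 by simp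
  next
    case 3
    then have "p \<notin> K1" "p \<notin> K2" using sub dis p x unfolding K by auto
    then have "{b \<in> ?B. p \<in> b} = ?A" using pB2 3 unfolding K[symmetric] by blast
    then show ?thesis using A by simp
  qed
qed

text \<open>For the condition on pairs: the two new blocks are disjoint, and a new block meets an
  old block of one side within the removed block of that side, and an old block of the other side at
  most in the single exchanged point.\<close>

lemma symmetric_configuration_glue:
  fixes x1 x2 :: 'a
  assumes S1: "symmetric_configuration v1 P1 B1" and L1: "L1 \<in> B1" "x1 \<in> L1"
    and S2: "symmetric_configuration v2 P2 B2" and L2: "L2 \<in> B2" "x2 \<in> L2"
    and dis: "P1 \<inter> P2 = {}"
  shows "symmetric_configuration (v1 + v2) (P1 \<union> P2)
    ((B1 - {L1}) \<union> (B2 - {L2}) \<union> {insert x2 (L1 - {x1}), insert x1 (L2 - {x2})})"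
    (is "symmetric_configuration _ ?P ?B")
proof (rule symmetric_configurationI)
  define K1 K2 where K: "K1 = insert x2 (L1 - {x1})" "K2 = insert x1 (L2 - {x2})"
  note D1 = symmetric_configurationD[OF S1] and D2 = symmetric_configurationD[OF S2]
  have sub: "L1 \<subseteq> P1" "L2 \<subseteq> P2" using D1(8) D2(8) L1 L2 by auto
  then have x: "x1 \<in> P1" "x2 \<in> P2" "x1 \<notin> P2" "x2 \<notin> P1" using L1 L2 dis by auto
  show "finite ?P" using D1(1) D2(1) by simp
  show "card ?P = v1 + v2" using D1 D2 dis by (simp add: card_Un_disjoint)
  show "?B \<subseteq> Pow ?P"
    using D1(3) D2(3) sub x by blast
  have "card K1 = 3"
    using D1(6,7)[OF L1(1)] L1 sub x unfolding K by (subst card_insert_disjoint) auto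
  moreover have "card K2 = 3"
    using D2(6,7)[OF L2(1)] L2 sub x unfolding K by (subst card_insert_disjoint) auto
  ultimately show "card b = 3" if "b \<in> ?B" for b using that D1(6) D2(6) unfolding K by blast
  show "card {b \<in> ?B. p \<in> b} = 3" if "p \<in> ?P" for p
  proof (cases "p \<in> P1")
    case True
    then show ?thesis using glue_degree[OF S1 L1 S2 L2 dis] by simp
  next
    case False
    then have "p \<in> P2" using that by simp
    then show ?thesis using glue_degree[OF S2 L2 S1 L1, of p] dis
      by (simp only: Un_commute insert_commute Int_commute)
  qed
  show "b = c" if h: "b \<in> ?B" "c \<in> ?B" "p \<in> b" "q \<in> b" "p \<in> c" "q \<in> c" "p \<noteq> q" for p q b c
  proof -
    have KK: "K1 \<inter> K2 = {}" using sub x dis unfolding K by blast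
    have b2: "d \<inter> P2 = {}" if "d \<in> B1" for d using D1(8)[OF that] dis by blast
    have b1: "d \<inter> P1 = {}" if "d \<in> B2" for d using D2(8)[OF that] dis by blast
    have K1: "\<not> {p,q} \<subseteq> d \<inter> K1" if "d \<in> (B1 - {L1}) \<union> (B2 - {L2})" for d
    proof (cases "d \<in> B1")
      case True
      then have "d \<inter> K1 \<subseteq> d \<inter> L1" using b2 x unfolding K by blast
      moreover have "d \<noteq> L1" using that True sub D2(8) b1 L1 x by blast
      ultimately show ?thesis using D1(10)[OF True L1(1), of p q] h(7) by blast
    next
      case False
      then have "d \<inter> K1 \<subseteq> {x2}" using that b1 sub unfolding K by blast
      then show ?thesis using h(7) by blast
    qed
    have K2: "\<not> {p,q} \<subseteq> d \<inter> K2" if "d \<in> (B1 - {L1}) \<union> (B2 - {L2})" for d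
    proof (cases "d \<in> B2")
      case True
      then have "d \<inter> K2 \<subseteq> d \<inter> L2" using b1 x unfolding K by blast
      moreover have "d \<noteq> L2" using that True sub D1(8) b2 L2 x by blast
      ultimately show ?thesis using D2(10)[OF True L2(1), of p q] h(7) by blast
    next
      case False
      then have "d \<inter> K2 \<subseteq> {x1}" using that b2 sub unfolding K by blast
      then show ?thesis using h(7) by blast
    qed
    have BB: "b = c" if "b \<in> B1 \<union> B2" "c \<in> B1 \<union> B2"
    proof -
      have "b \<in> B1 \<and> c \<in> B1 \<or> b \<in> B2 \<and> c \<in> B2"
        using that D1(8) h(3,5) b1 by blast
      then show ?thesis
        using D1(10)[of b c p q, OF _ _ h(3-7)] D2(10)[of b c p q, OF _ _ h(3-7)] by blast
    qed
    define R where "R = (B1 - {L1}) \<union> (B2 - {L2})"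
    have R: "d = e" if "d \<in> R" "e \<in> {K1, K2}" "{p, q} \<subseteq> d \<inter> e" for d e
      using K1 K2 that unfolding R_def by blast
    have pq: "{p, q} \<subseteq> b \<inter> c" "{p, q} \<subseteq> c \<inter> b" using h(3-6) by simp_all
    have "b \<in> R \<or> b \<in> {K1, K2}" "c \<in> R \<or> c \<in> {K1, K2}"
      using h(1,2) unfolding K R_def by blast+
    then consider "b \<in> R" "c \<in> R" | "b \<in> R" "c \<in> {K1, K2}" | "c \<in> R" "b \<in> {K1, K2}"
      | "b \<in> {K1, K2}" "c \<in> {K1, K2}" by argo
    then show ?thesis
    proof cases
      case 1
      then show ?thesis using BB unfolding R_def by blast
    next
      case 2
      then show ?thesis using R pq(1) by simp
    next
      case 3
      then show ?thesis using R[OF _ _ pq(2)] by simp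
    next
      case 4
      then show ?thesis using KK h(3,5) by auto
    qed
  qed
qed

definition extendable :: "nat \<Rightarrow> nat \<Rightarrow> bool" where
  "extendable v t \<longleftrightarrow> (\<exists>(P :: nat set) B x L. symmetric_configuration v P B \<and> L \<in> B \<and> x \<in> L \<and>
     linked P (B - {L}) \<and> t \<le> card (triangles (B - {L})))"

text \<open>The flag \<open>(x, L)\<close> is the place where the next piece is inserted, so the triangles through
  \<open>L\<close> are disregarded. In the next lemma \<open>z\<close> stands for the old point \<open>x\<close> seen from the new piece.\<close>

lemma extendable_glue:
  fixes P0 :: "nat set"
  assumes ext: "extendable v t"
    and S0: "symmetric_configuration w P0 B0" and L0: "L0 \<in> B0" "x0 \<in> L0"
    and link0: "linked P0 (B0 - {L0})" and z: "z \<notin> P0"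
    and s: "s \<le> card (triangles (insert (insert z (L0 - {x0})) (B0 - {L0})))"
  shows "extendable (v + w) (t + s)"
proof -
  obtain P :: "nat set" and B x L where S: "symmetric_configuration v P B" and L: "L \<in> B" "x \<in> L"
    and link: "linked P (B - {L})" and t: "t \<le> card (triangles (B - {L}))"
    using ext unfolding extendable_def by (elim exE conjE) (rule that)
  note D = symmetric_configurationD[OF S] and D0 = symmetric_configurationD[OF S0]
  obtain N where N: "\<And>p. p \<in> P \<Longrightarrow> p < N"
    using D(1) finite_nat_set_iff_bounded by auto
  \<comment> \<open>Shifting by a bound of \<open>P\<close> makes the copy of the new piece disjoint
    from \<open>P\<close>.\<close>
  define g where "g = (\<lambda>j. N + j)"
  have g: "inj g" unfolding g_def by simp
  define P2 B2 L2 x2 where d2: "P2 = g ` P0" "B2 = (`) g ` B0" "L2 = g ` L0" "x2 = g x0"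
  have S2: "symmetric_configuration w P2 B2"
    unfolding d2 by (rule symmetric_configuration_image[OF S0 g])
  note D2 = symmetric_configurationD[OF S2]
  have L2: "L2 \<in> B2" "x2 \<in> L2" using L0 unfolding d2 by auto
  have dis: "P \<inter> P2 = {}" using N unfolding d2 g_def by fastforce
  define K1 K2 where K: "K1 = insert x2 (L - {x})" "K2 = insert x (L2 - {x2})"
  define B' where "B' = (B - {L}) \<union> (B2 - {L2}) \<union> {K1, K2}"
  have S': "symmetric_configuration (v + w) (P \<union> P2) B'"
    unfolding B'_def K by (rule symmetric_configuration_glue[OF S L S2 L2 dis])
  have sub: "L \<subseteq> P" "L2 \<subseteq> P2" using D(8) D2(8) L L2 by auto
  then have x: "x \<in> P" "x2 \<in> P2" "x \<notin> P2" "x2 \<notin> P" using L L2 dis by auto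
  have "card (L - {x}) = 2" using D(6)[OF L(1)] L(2) by simp
  then have "L - {x} \<noteq> {}" by fastforce
  then have K1P: "K1 \<inter> P \<noteq> {}" "K1 \<inter> P2 \<noteq> {}" using sub x unfolding K by blast+
  have "card (L2 - {x2}) = 2" using D2(6)[OF L2(1)] L2(2) by simp
  then have "L2 - {x2} \<noteq> {}" by fastforce
  then have K2P: "K2 \<inter> P \<noteq> {}" "K2 \<inter> P2 \<noteq> {}" using sub x unfolding K by blast+
  have "x2 \<in> K1" "x2 \<notin> K2" using x unfolding K by auto
  then have K12: "K1 \<noteq> K2" by blast
  have KB: "K1 \<notin> B" "K2 \<notin> B" "K1 \<notin> B2" "K2 \<notin> B2"
    using K1P K2P D(8) D2(8) dis by blast+
  \<comment> \<open>The next flag is \<open>(x2, K1)\<close>. Removing \<open>K1\<close> leaves the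
    old blocks \<open>B - {L}\<close> and the new part \<open>C\<close>; the block \<open>K2\<close>
    in \<open>C\<close> holds the two point sets together.\<close>
  define C where "C = insert K2 (B2 - {L2})"
  have B'K: "B' - {K1} = (B - {L}) \<union> C" using K12 KB unfolding B'_def C_def by blast
  have "linked (P \<union> P2) (B' - {K1})"
  proof (rule linked_Un[OF link])
    have "inj ((`) g)" by (rule injI) (simp add: inj_image_eq_iff[OF g])
    then have "B2 - {L2} = (`) g ` (B0 - {L0})" unfolding d2 by (simp add: image_set_diff)
    then show "linked P2 (B2 - {L2})" unfolding d2(1) using linked_image[OF link0] by simp
    show "K2 \<inter> P \<noteq> {}" "K2 \<inter> P2 \<noteq> {}" by fact+
  qed (auto simp: B'K C_def)
  moreover have "t + s \<le> card (triangles (B' - {K1}))"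
  proof -
    \<comment> \<open>Sending \<open>z\<close> to \<open>x\<close> turns the template block
      \<open>insert z (L0 - {x0})\<close> into \<open>K2\<close>, so the triangles counted in the
      template reappear in \<open>C\<close>.\<close>
    define h where "h = (\<lambda>j. if j = z then x else g j)"
    have fin: "finite B" "finite C" using D(5) D2(5) unfolding C_def by simp_all
    have hg: "h ` A = g ` A" if "A \<subseteq> P0" for A
      using that z unfolding h_def by (intro image_cong) auto
    have hL: "h ` insert z (L0 - {x0}) = K2"
    proof -
      have "h ` (L0 - {x0}) = g ` (L0 - {x0})" using hg D0(8)[OF L0(1)] by blast
      also have "\<dots> = L2 - {x2}" using g unfolding d2 by (simp add: image_set_diff)
      finally have "h ` (L0 - {x0}) = L2 - {x2}" .
      moreover have "h z = x" unfolding h_def by simp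
      ultimately show ?thesis unfolding K image_insert by (simp only:)
    qed
    have "(`) h ` (B0 - {L0}) = (`) g ` (B0 - {L0})"
      using hg[OF D0(8)] by (rule image_cong[OF refl]) blast
    also have "\<dots> = B2 - {L2}"
      unfolding d2 using inj_image_eq_iff[OF g] by blast
    finally have hC: "(`) h ` insert (insert z (L0 - {x0})) (B0 - {L0}) = C"
      using hL by (simp only: C_def image_insert[of "(`) h"])
    have "inj_on h (insert z P0)"
      using z N x(1) unfolding h_def g_def by (auto simp: inj_on_def)
    moreover have "insert (insert z (L0 - {x0})) (B0 - {L0}) \<subseteq> Pow (insert z P0)"
      using D0(8) L0 by blast
    moreover have "finite (insert (insert z (L0 - {x0})) (B0 - {L0}))" using D0(5) by simp
    ultimately have sC: "s \<le> card (triangles C)"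
      using le_trans[OF s card_triangles_image[of h "insert z P0"]] hC by simp
    have "(B - {L}) \<inter> C = {}"
    proof -
      have False if "b \<in> B" "b \<in> B2" for b
      proof -
        have "b = {}" using D(8)[OF that(1)] D2(8)[OF that(2)] dis by blast
        then show False using D(6)[OF that(1)] by simp
      qed
      then show ?thesis using KB unfolding C_def by blast
    qed
    moreover have "card (triangles (B - {L}) \<union> triangles C) \<le> card (triangles (B' - {K1}))"
      unfolding B'K using fin by (intro card_mono triangles_finite Un_least triangles_mono) auto
    ultimately show ?thesis using sC t fin
      by (simp add: card_Un_disjoint triangles_finite triangles_disjoint)
  qed
  moreover have "K1 \<in> B'" "x2 \<in> K1" unfolding B'_def K by simp_all
  ultimately show ?thesis using S' unfolding extendable_def by blast
qed

section \<open>Chains of Fano planes\<close>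

text \<open>The translates of the difference set {0,1,3} modulo 7.\<close>

definition fano :: "nat set set" where
  "fano = {{0,1,3}, {1,2,4}, {2,3,5}, {3,4,6}, {4,5,0}, {5,6,1}, {6,0,2}}"

text \<open>The same base block modulo 8: its differences 1, 2, 3 and their negatives are distinct,
  so a pair lies in at most one translate, and points at difference 4 are not joined.\<close>

definition moebius_kantor :: "nat set set" where
  "moebius_kantor = {{0,1,3}, {1,2,4}, {2,3,5}, {3,4,6}, {4,5,7}, {5,6,0}, {6,7,1}, {7,0,2}}"

section \<open>Verifying the two building blocks by evaluation\<close>

lemma Collect_insert_if:
  "{x \<in> insert a B. Q x} = (if Q a then insert a {x \<in> B. Q x} else {x \<in> B. Q x})" by auto

lemma lessThan_7_8: "{..<7::nat} = {0,1,2,3,4,5,6}" "{..<8::nat} = {0,1,2,3,4,5,6,7}" by auto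

lemma symmetric_configurationI_card_Int:
  assumes "finite P" "card P = v" "B \<subseteq> Pow P" "\<forall>b\<in>B. card b = 3"
    and "\<forall>p\<in>P. card {b \<in> B. p \<in> b} = 3"
    and "\<forall>b\<in>B. \<forall>c\<in>B. b = c \<or> card (b \<inter> c) \<le> 1"
  shows "symmetric_configuration v P B"
proof (rule symmetric_configurationI)
  show "b = c" if h: "b \<in> B" "c \<in> B" "p \<in> b" "q \<in> b" "p \<in> c" "q \<in> c" "p \<noteq> q" for p q b c
  proof (rule ccontr)
    assume "b \<noteq> c"
    then have "card (b \<inter> c) \<le> 1" using assms(6) h by blast
    moreover have "finite (b \<inter> c)" using assms(1,3) h(1) by (meson PowD finite_Int finite_subset subsetD)
    moreover have "{p,q} \<subseteq> b \<inter> c" using h by simp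
    ultimately have "card {p,q} \<le> 1" by (meson card_mono order_trans)
    then show False using h(7) by simp
  qed
qed (use assms in auto)

lemma symmetric_configuration_fano: "symmetric_configuration 7 {..<7} fano"
proof (rule symmetric_configurationI_card_Int)
  show "\<forall>p\<in>{..<7}. card {b \<in> fano. p \<in> b} = 3"
    unfolding fano_def lessThan_7_8
    by (simp only: Collect_insert_if ball_simps, simp, intro conjI) (simp_all add: set_eq_subset)
qed (simp_all add: fano_def)

lemma symmetric_configuration_moebius_kantor: "symmetric_configuration 8 {..<8} moebius_kantor"
proof (rule symmetric_configurationI_card_Int)
  show "\<forall>p\<in>{..<8}. card {b \<in> moebius_kantor. p \<in> b} = 3"
    unfolding moebius_kantor_def lessThan_7_8
    by (simp only: Collect_insert_if ball_simps, simp, intro conjI) (simp_all add: set_eq_subset)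
  show "\<forall>b\<in>moebius_kantor. card b = 3" "moebius_kantor \<subseteq> Pow {..<8}"
    by (simp_all add: moebius_kantor_def)
  show "\<forall>b\<in>moebius_kantor. \<forall>c\<in>moebius_kantor. b = c \<or> card (b \<inter> c) \<le> 1"
    by (simp add: moebius_kantor_def)
qed simp_all

lemma fano_Diff: "fano - {{0,1,3}} = {{1,2,4}, {2,3,5}, {3,4,6}, {4,5,0}, {5,6,1}, {6,0,2}}"
  unfolding fano_def by (rule Diff_insert_absorb) (simp add: set_eq_subset)

lemma moebius_kantor_Diff: "moebius_kantor - {{0,1,3}} =
   {{1,2,4}, {2,3,5}, {3,4,6}, {4,5,7}, {5,6,0}, {6,7,1}, {7,0,2}}"
  unfolding moebius_kantor_def by (rule Diff_insert_absorb) (simp add: set_eq_subset)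

lemma linked_block: "b \<in> C \<Longrightarrow> linked b C"
  unfolding linked_def by blast

lemma linked_Un_block:
  assumes "linked P C" "b \<in> C" "b \<inter> P \<noteq> {}"
  shows "linked (P \<union> b) C"
  using linked_Un[OF assms(1) linked_block[OF assms(2)] assms(2,3)] assms(2,3) by blast

lemma linked_fano: "linked {..<7} (fano - {{0,1,3}})"
proof -
  let ?C = "fano - {{0,1,3}}"
  \<comment> \<open>A walk through blocks other than {0,1,3}, each meeting the union of its
    predecessors, that reaches all seven points.\<close>
  have "linked ({1,2,4} \<union> {2,3,5} \<union> {3,4,6} \<union> {4,5,0}) ?C"
    unfolding fano_Diff by (intro linked_Un_block linked_block) simp_all
  moreover have "{1,2,4} \<union> {2,3,5} \<union> {3,4,6} \<union> {4,5,0} = {..<7::nat}" by auto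
  ultimately show ?thesis by simp
qed

lemma linked_moebius_kantor: "linked {..<8} (moebius_kantor - {{0,1,3}})"
proof -
  let ?C = "moebius_kantor - {{0,1,3}}"
  have "linked ({1,2,4} \<union> {2,3,5} \<union> {3,4,6} \<union> {4,5,7} \<union> {5,6,0}) ?C"
    unfolding moebius_kantor_Diff by (intro linked_Un_block linked_block) simp_all
  moreover have "{1,2,4} \<union> {2,3,5} \<union> {3,4,6} \<union> {4,5,7} \<union> {5,6,0} = {..<8::nat}" by auto
  ultimately show ?thesis by simp
qed

text \<open>The vertices are \<open>a\<close>, \<open>b\<close>, \<open>c\<close>; the third points
  on the sides \<open>ab\<close>, \<open>ac\<close>, \<open>bc\<close> are \<open>f\<close>,
  \<open>e\<close>, \<open>d\<close>.\<close>

definition hexagram :: "'a \<Rightarrow> 'a \<Rightarrow> 'a \<Rightarrow> 'a \<Rightarrow> 'a \<Rightarrow> 'a \<Rightarrow> 'a set set" where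
  "hexagram a b c d e f = {{a,b,f}, {a,c,e}, {b,c,d}}"

lemma hexagram_in_triangles:
  assumes "distinct [a, b, c, d, e, f]" "{a,b,f} \<in> B" "{a,c,e} \<in> B" "{b,c,d} \<in> B"
  shows "hexagram a b c d e f \<in> triangles B"
proof -
  have "hexagram a b c d e f \<subseteq> B" using assms(2-4) unfolding hexagram_def by simp
  then show ?thesis
    unfolding triangles_def mem_Collect_eq
    by (intro conjI exI) (assumption, rule assms(1), rule hexagram_def)
qed

text \<open>Among the six blocks other than {0,1,3}, 20 triples can be chosen, of which 4 are
  concurrent (at 2, 4, 5, 6); this leaves 16 triangles. The changed block {7,1,3} still meets the
  two other blocks through 1 and the two through 3, which gives 2 * 2 more, listed first.\<close>

lemma card_triangles_fano:
  "20 \<le> card (triangles (insert (insert 7 ({0,1,3} - {0})) (fano - {{0,1,3}})))"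
    (is "_ \<le> card (triangles ?F)")
proof -
  let ?H = "[hexagram (1::nat) 3 2 5 4 7, hexagram 1 3 4 6 2 7, hexagram 3 1 5 6 2 7, hexagram 3 1 6 5 4 7,
    hexagram 2 4 3 6 5 1, hexagram 2 4 5 0 3 1, hexagram 2 1 5 6 3 4, hexagram 4 1 6 5 3 2,
    hexagram 4 2 6 0 3 1, hexagram 4 1 5 6 0 2, hexagram 4 2 0 6 5 1, hexagram 1 2 6 0 5 4,
    hexagram 3 5 4 0 6 2, hexagram 3 5 6 1 4 2, hexagram 3 2 6 0 4 5, hexagram 5 2 0 6 4 3,
    hexagram 5 2 6 0 1 3, hexagram 4 6 5 1 0 3, hexagram 4 6 0 2 5 3, hexagram 5 0 6 2 1 4]"
  have "insert 7 ({0,1,3} - {0}) = {7,1,3::nat}" by auto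
  then have F: "?F = {{7,1,3}, {1,2,4}, {2,3,5}, {3,4,6}, {4,5,0}, {5,6,1}, {6,0,2}}"
    unfolding fano_Diff by simp
  have sub: "set ?H \<subseteq> triangles ?F"
    unfolding F list.set insert_subset
    by (intro conjI hexagram_in_triangles empty_subsetI) (simp_all add: insert_commute)
  have "distinct ?H"
    unfolding hexagram_def by (simp add: set_eq_subset)
  then have "card (set ?H) = length ?H" by (rule distinct_card)
  then have "card (set ?H) = 20" by (simp only: list.size)
  moreover have "finite (triangles ?F)" unfolding F by (intro triangles_finite) simp
  ultimately show ?thesis using card_mono[OF _ sub] by presburger
qed

lemma extendable_add_7: "extendable v t \<Longrightarrow> extendable (v + 7) (t + 20)"
  by (rule extendable_glue[OF _ symmetric_configuration_fano _ _ linked_fano _ card_triangles_fano])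
     (simp_all add: fano_def)

text \<open>Since 8 is 1 modulo 7, these steps move through the residue classes. There are at most
  six of them in a chain used later, so their triangles can be left uncounted.\<close>

lemma extendable_add_8: "extendable v t \<Longrightarrow> extendable (v + 8) t"
  using extendable_glue[OF _ symmetric_configuration_moebius_kantor _ _ linked_moebius_kantor,
      of v t 0 8 0]
  by (simp add: moebius_kantor_def)

lemma extendable_fano: "extendable 7 0"
  unfolding extendable_def
  by (rule exI[of _ "{..<7}"], rule exI[of _ fano], rule exI[of _ 0], rule exI[of _ "{0,1,3}"])
     (intro conjI symmetric_configuration_fano linked_fano, simp_all add: fano_def)

lemma extendable_steps: "extendable (7 + 7 * n + 8 * r) (20 * n)"
proof (induction r)
  case 0
  show ?case
  proof (induction n)
    case 0
    show ?case using extendable_fano by simp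
  next
    case (Suc n)
    then show ?case using extendable_add_7[of "7 + 7 * n + 8 * 0" "20 * n"] by (simp add: algebra_simps)
  qed
next
  case (Suc r)
  then show ?case using extendable_add_8[of "7 + 7 * n + 8 * r" "20 * n"] by (simp add: algebra_simps)
qed

section \<open>From chains to the lower limit\<close>

lemma finite_num_triangles:
  "finite {num_triangles B | (P :: nat set) B. connected_symmetric_configuration v P B}"
proof (rule finite_subset)
  \<comment> \<open>There are infinitely many configurations on sets of natural numbers, but each
    has at most as many triangles as there are subsets of its \<open>v\<close> blocks.\<close>
  show "{num_triangles B | (P :: nat set) B. connected_symmetric_configuration v P B} \<subseteq> {..2 ^ v}"
  proof
    fix k assume "k \<in> {num_triangles B | (P :: nat set) B. connected_symmetric_configuration v P B}"
    then obtain P :: "nat set" and B where k: "k = num_triangles B"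
      and "connected_symmetric_configuration v P B" by blast
    then have S: "symmetric_configuration v P B" unfolding connected_symmetric_configuration_def by simp
    have "triangles B \<subseteq> Pow B" using triangles_memD(1) by blast
    then have "card (triangles B) \<le> card (Pow B)"
      using symmetric_configurationD(5)[OF S] by (intro card_mono) simp_all
    then show "k \<in> {..2 ^ v}"
      using symmetric_configurationD(4,5)[OF S] by (simp add: k num_triangles_def card_Pow)
  qed
qed simp

lemma extendable_imp_connected:
  assumes "extendable v t"
  obtains P :: "nat set" and B where "connected_symmetric_configuration v P B" "t \<le> num_triangles B"
proof -
  obtain P :: "nat set" and B x L where S: "symmetric_configuration v P B"
    and link: "linked P (B - {L})" and t: "t \<le> card (triangles (B - {L}))"
    using assms unfolding extendable_def by (elim exE conjE) (rule that)
  have "linked P B"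
    using link unfolding linked_def by (meson Diff_subset subset_iff)
  then have "connected_symmetric_configuration v P B"
    using S linked_imp_not_decomposable unfolding connected_symmetric_configuration_def by blast
  moreover have "card (triangles (B - {L})) \<le> card (triangles B)"
    using symmetric_configurationD(5)[OF S] by (intro card_mono triangles_finite triangles_mono) auto
  ultimately show ?thesis using that t unfolding num_triangles_def by force
qed

lemma extendable_imp_max_triangles_ge:
  assumes "extendable v t"
  shows "t \<le> max_triangles v"
proof -
  obtain P :: "nat set" and B where C: "connected_symmetric_configuration v P B" "t \<le> num_triangles B"
    using extendable_imp_connected[OF assms] .
  have "num_triangles B \<le> max_triangles v"
    unfolding max_triangles_def using C(1) by (intro Max_ge finite_num_triangles) blast
  then show ?thesis using C(2) by simp
qed

lemma extendable_large:
  assumes "v \<ge> 55"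
  obtains t where "extendable v t" "20 * real v \<le> 7 * real t + 1100"
proof -
  \<comment> \<open>Writing \<open>v = 7 + 7 * n + 8 * r\<close> uses \<open>r\<close> pieces of
    size 8. As \<open>v \<ge> 55\<close> gives \<open>v div 7 \<ge> 7\<close>, and
    \<open>r \<le> 6\<close>, the subtraction does not truncate. The constant 1100 is 20 * 7 + 20 *
    8 * 6.\<close>
  define r n where rn: "r = v mod 7" "n = v div 7 - r - 1"
  have v: "v = 7 * (v div 7) + r" "r \<le> 6" unfolding rn by (simp_all add: less_Suc_eq_le[symmetric])
  then have "v = 7 + 7 * n + 8 * r" unfolding rn(2) using assms by linarith
  moreover from this have "20 * real v \<le> 7 * real (20 * n) + 1100" using v(2) by simp
  ultimately show ?thesis using that extendable_steps by metis
qed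

lemma liminf_max_triangles_ge:
  "liminf (\<lambda>v. ereal (real (max_triangles v) / real v)) \<ge> ereal (20 / 7)"
proof -
  let ?g = "\<lambda>v. 20 / 7 - 1100 / 7 * inverse (real v)"
  have "(\<lambda>v. inverse (real v)) \<longlonglongrightarrow> 0" by (rule lim_inverse_n)
  then have "?g \<longlonglongrightarrow> 20 / 7 - 1100 / 7 * 0"
    by (intro tendsto_diff tendsto_const tendsto_mult_left)
  then have "liminf (\<lambda>v. ereal (?g v)) = ereal (20 / 7)"
    by (intro lim_imp_Liminf) simp_all
  moreover have "ereal (?g v) \<le> ereal (real (max_triangles v) / real v)" if "v \<ge> 55" for v
  proof -
    obtain t where t: "extendable v t" "20 * real v \<le> 7 * real t + 1100"
      using extendable_large \<open>v \<ge> 55\<close> by blast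
    then have "20 * real v \<le> 7 * real (max_triangles v) + 1100"
      using extendable_imp_max_triangles_ge[OF t(1)] by linarith
    then have "(20 * real v - 1100) / 7 / real v \<le> real (max_triangles v) / real v"
      by (intro divide_right_mono) simp_all
    moreover have "?g v = (20 * real v - 1100) / 7 / real v"
      using that by (simp add: field_simps)
    ultimately show ?thesis by simp
  qed
  then have "liminf (\<lambda>v. ereal (?g v)) \<le> liminf (\<lambda>v. ereal (real (max_triangles v) / real v))"
    by (intro Liminf_mono eventually_sequentiallyI[of 55])
  ultimately show ?thesis by simp
qed

section \<open>Triangles through a block\<close>

lemma card_offdiagonal:
  assumes "finite A"
  shows "card {(x, y). x \<in> A \<and> y \<in> A \<and> x \<noteq> y} = card A * (card A - 1)"
proof -
  have "{(x, y). x \<in> A \<and> y \<in> A \<and> x \<noteq> y} = (SIGMA x:A. A - {x})" by auto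
  then show ?thesis using assms by simp
qed

locale sym_conf =
  fixes v :: nat and P :: "'a set" and B :: "'a set set"
  assumes sym_conf: "symmetric_configuration v P B"
begin

lemmas conf = symmetric_configurationD[OF sym_conf]

text \<open>The number of blocks in \<open>near s b\<close> is \<open>k(s)\<close>. Pairs in \<open>corners b\<close> are ordered, so each triangle
  through \<open>b\<close> is counted twice.\<close>

definition near :: "'a \<Rightarrow> 'a set \<Rightarrow> 'a set set" where
  "near s b = {x \<in> B. s \<in> x \<and> x \<inter> b \<noteq> {}}"

definition corners :: "'a set \<Rightarrow> ('a set \<times> 'a set) set" where
  "corners b = {(x, y). x \<in> B \<and> y \<in> B \<and> b \<noteq> x \<and> b \<noteq> y \<and> x \<noteq> y \<and>
     b \<inter> x \<noteq> {} \<and> b \<inter> y \<noteq> {} \<and> x \<inter> y \<noteq> {} \<and> b \<inter> x \<inter> y = {}}"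

lemma corners_commute: "b \<in> B \<Longrightarrow> (x, y) \<in> corners b \<Longrightarrow> (b, y) \<in> corners x"
  unfolding corners_def by blast

lemma corners_swap: "(x, y) \<in> corners b \<Longrightarrow> (y, x) \<in> corners b"
  unfolding corners_def by blast

lemma finite_corners: "finite (corners b)"
  by (rule finite_subset[of _ "B \<times> B"]) (auto simp: corners_def conf(5))

lemma finite_near: "finite (near s b)"
  unfolding near_def using conf(5) by simp

lemma card_near_le: "s \<in> P \<Longrightarrow> card (near s b) \<le> 3"
  using conf(9)[of s] conf(5) unfolding near_def
  by (metis (no_types, lifting) card_mono card.infinite mem_Collect_eq subsetI zero_neq_numeral)

text \<open>The two blocks of a corner meet in a point \<open>s\<close> off \<open>b\<close>.
  Conversely, two blocks through such an \<open>s\<close> that both meet \<open>b\<close> cannot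
  also share a point of \<open>b\<close>.\<close>

lemma corners_eq:
  assumes "b \<in> B"
  shows "corners b = (\<Union>s\<in>P - b. {(x, y). x \<in> near s b \<and> y \<in> near s b \<and> x \<noteq> y})"
proof -
  have "(x, y) \<in> corners b \<longleftrightarrow> (\<exists>s\<in>P - b. x \<in> near s b \<and> y \<in> near s b \<and> x \<noteq> y)" for x y
  proof
    assume A: "(x, y) \<in> corners b"
    then obtain s where s: "s \<in> x" "s \<in> y" unfolding corners_def by blast
    then have "s \<in> P - b" using A conf(8) unfolding corners_def by blast
    then show "\<exists>s\<in>P - b. x \<in> near s b \<and> y \<in> near s b \<and> x \<noteq> y"
      using A s unfolding corners_def near_def by blast
  next
    assume "\<exists>s\<in>P - b. x \<in> near s b \<and> y \<in> near s b \<and> x \<noteq> y"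
    then obtain s where s: "s \<in> P" "s \<notin> b" "s \<in> x" "s \<in> y" "x \<in> B" "y \<in> B"
       "x \<inter> b \<noteq> {}" "y \<inter> b \<noteq> {}" "x \<noteq> y" unfolding near_def by blast
    have "b \<inter> x \<inter> y = {}"
      using conf(10)[OF s(5,6,3) _ s(4)] s(2,9) by blast
    then show "(x, y) \<in> corners b" using s unfolding corners_def by blast
  qed
  then show ?thesis by auto
qed

lemma card_corners:
  assumes "b \<in> B"
  shows "card (corners b) = (\<Sum>s\<in>P - b. card (near s b) * (card (near s b) - 1))"
proof -
  have "card (corners b) =
      (\<Sum>s\<in>P - b. card {(x, y). x \<in> near s b \<and> y \<in> near s b \<and> x \<noteq> y})"
    unfolding corners_eq[OF assms]
  proof (rule card_UN_disjoint)
    show "finite (P - b)" using conf(1) by simp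
    show "\<forall>s\<in>P - b. finite {(x, y). x \<in> near s b \<and> y \<in> near s b \<and> x \<noteq> y}"
      by (intro ballI finite_subset[OF _ finite_cartesian_product[OF finite_near finite_near]]) blast
    show "\<forall>s\<in>P - b. \<forall>t\<in>P - b. s \<noteq> t \<longrightarrow>
       {(x, y). x \<in> near s b \<and> y \<in> near s b \<and> x \<noteq> y} \<inter>
       {(x, y). x \<in> near t b \<and> y \<in> near t b \<and> x \<noteq> y} = {}"
      using conf(10) unfolding near_def by blast
  qed
  then show ?thesis by (simp add: card_offdiagonal finite_near)
qed

text \<open>Each of the three points of \<open>b\<close> lies on two further blocks, and none of
  these is counted twice because it shares just one point with \<open>b\<close>.\<close>

lemma card_neighbours:
  assumes b: "b \<in> B"
  shows "card {x \<in> B. x \<noteq> b \<and> x \<inter> b \<noteq> {}} = 6"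
proof -
  have eq: "{x \<in> B. x \<noteq> b \<and> x \<inter> b \<noteq> {}} = (\<Union>p\<in>b. {x \<in> B. p \<in> x} - {b})" by blast
  have "card (\<Union>p\<in>b. {x \<in> B. p \<in> x} - {b}) = (\<Sum>p\<in>b. card ({x \<in> B. p \<in> x} - {b}))"
  proof (rule card_UN_disjoint)
    show "\<forall>p\<in>b. \<forall>q\<in>b. p \<noteq> q \<longrightarrow> ({x \<in> B. p \<in> x} - {b}) \<inter> ({x \<in> B. q \<in> x} - {b}) = {}"
      using conf(10)[OF b] by blast
  qed (use conf(5,7) b in auto)
  also have "\<dots> = (\<Sum>p\<in>b. 2)"
  proof (rule sum.cong[OF refl])
    fix p assume "p \<in> b"
    then have "card {x \<in> B. p \<in> x} = 3" "b \<in> {x \<in> B. p \<in> x}" using conf(8,9) b by blast+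
    then show "card ({x \<in> B. p \<in> x} - {b}) = 2" by simp
  qed
  also have "\<dots> = 6" using conf(6)[OF b] by simp
  finally show ?thesis unfolding eq .
qed

lemma inter_singleton:
  assumes "x \<in> B" "y \<in> B" "x \<noteq> y" "p \<in> x" "p \<in> y"
  shows "x \<inter> y = {p}"
  using conf(10)[OF assms(1,2,4) _ assms(5)] assms by blast

text \<open>Count the incidences between the six neighbours of \<open>b\<close> and the points off
  \<open>b\<close>: each neighbour has two such points.\<close>

lemma sum_near:
  assumes b: "b \<in> B"
  shows "(\<Sum>s\<in>P - b. card (near s b)) = 12"
proof -
  let ?N = "{x \<in> B. x \<noteq> b \<and> x \<inter> b \<noteq> {}}"
  have "(\<Sum>s\<in>P - b. card (near s b)) = (\<Sum>s\<in>P - b. card {x \<in> ?N. s \<in> x})"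
    unfolding near_def by (intro sum.cong refl arg_cong[where f = card]) blast
  also have "\<dots> = (\<Sum>x\<in>?N. card {s \<in> P - b. s \<in> x})"
    using conf(1,5) by (intro sum_multicount_gen[symmetric]) auto
  also have "\<dots> = (\<Sum>x\<in>?N. 2)"
  proof (rule sum.cong[OF refl])
    fix x assume x: "x \<in> ?N"
    then obtain p where p: "p \<in> x" "p \<in> b" by blast
    have "{s \<in> P - b. s \<in> x} = x - {p}"
      using inter_singleton[OF _ b _ p, of ] x conf(8) by blast
    then show "card {s \<in> P - b. s \<in> x} = 2" using x p conf(6) by simp
  qed
  also have "\<dots> = 12" using card_neighbours[OF b] by simp
  finally show ?thesis .
qed

section \<open>The possible distributions of the values k(s)\<close>

definition level :: "nat \<Rightarrow> 'a set \<Rightarrow> 'a set" where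
  "level k b = {s \<in> P - b. card (near s b) = k}"

lemma sum_levels:
  fixes f :: "nat \<Rightarrow> nat"
  assumes "f 0 = 0"
  shows "(\<Sum>s\<in>P - b. f (card (near s b))) =
    f 1 * card (level 1 b) + f 2 * card (level 2 b) + f 3 * card (level 3 b)"
proof -
  have "(\<Sum>s\<in>P - b. f (card (near s b))) =
     (\<Sum>k\<in>{..3}. \<Sum>s\<in>{s \<in> P - b. card (near s b) = k}. f (card (near s b)))"
    using conf(1) card_near_le by (intro sum.group[symmetric]) auto
  also have "\<dots> = (\<Sum>k\<in>{..3}. f k * card (level k b))"
    by (intro sum.cong refl) (simp add: level_def)
  also have "{..3::nat} = {0,1,2,3}" by auto
  finally show ?thesis using assms by simp
qed

lemma level_equation:
  assumes "b \<in> B"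
  shows "card (level 1 b) + 2 * card (level 2 b) + 3 * card (level 3 b) = 12"
    and "card (corners b) = 2 * card (level 2 b) + 6 * card (level 3 b)"
  using sum_near[OF assms] card_corners[OF assms]
    sum_levels[of "\<lambda>k. k" b] sum_levels[of "\<lambda>k. k * (k - 1)" b] by simp_all

text \<open>Eliminating level 2 from \<open>level_equation\<close> gives 12 + 3 *
  \<open>card (level 3 b)\<close> - \<open>card (level 1 b)\<close> corners, and level 3 has at most
  four points. The threshold 18 stands for nine triangles, each counted twice.\<close>

lemma corners_cases:
  assumes "b \<in> B"
  obtains "card (corners b) \<le> 18"
  | "card (level 3 b) = 4" "level 1 b = {}" "level 2 b = {}"
  | "card (level 3 b) = 3" "card (level 2 b) = 1" "card (level 1 b) = 1"  "card (corners b) = 20"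
proof -
  have fin: "finite (level k b)" for k unfolding level_def using conf(1) by simp
  note E = level_equation[OF assms]
  consider "card (level 3 b) \<le> 2" | "card (level 3 b) = 3" | "card (level 3 b) = 4"
    | "card (level 3 b) \<ge> 5" by linarith
  then show ?thesis
  proof cases
    case 1
    then show ?thesis using E that(1) by linarith
  next
    case 2
    show ?thesis
    proof (cases "card (level 2 b) = 0")
      case True
      then show ?thesis using 2 E that(1) by simp
    next
      case False
      then have "card (level 2 b) = 1" using 2 E by linarith
      then show ?thesis using 2 E that(3) by simp
    qed
  next
    case 3
    then have "card (level 1 b) = 0" "card (level 2 b) = 0" using E by simp_all
    then show ?thesis using 3 that(2) fin by simp
  qed (use E in linarith)
qed

section \<open>Closed point sets and the Fano component\<close>

lemma symmetric_configuration_closed: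
  assumes "Q \<subseteq> P" "\<And>x. \<lbrakk>x \<in> B; x \<inter> Q \<noteq> {}\<rbrakk> \<Longrightarrow> x \<subseteq> Q"
  shows "symmetric_configuration (card Q) Q {x \<in> B. x \<subseteq> Q}"
proof (rule symmetric_configurationI)
  show "finite Q" using assms(1) conf(1) by (rule finite_subset)
  show "card {b \<in> {x \<in> B. x \<subseteq> Q}. p \<in> b} = 3" if "p \<in> Q" for p
  proof -
    have "{b \<in> {x \<in> B. x \<subseteq> Q}. p \<in> b} = {b \<in> B. p \<in> b}" using assms(2) that by blast
    then show ?thesis using conf(9) assms(1) that by auto
  qed
qed (use conf(6,10) in auto)

text \<open>The complement of a closed set is closed as well, and each side inherits the degree
  conditions.\<close>

lemma closed_imp_decomposable:
  assumes "Q \<subseteq> P" "\<And>x. \<lbrakk>x \<in> B; x \<inter> Q \<noteq> {}\<rbrakk> \<Longrightarrow> x \<subseteq> Q" "Q \<noteq> {}" "Q \<noteq> P"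
  shows "decomposable P B"
proof -
  have "x \<subseteq> P - Q" if "x \<in> B" "x \<inter> (P - Q) \<noteq> {}" for x
    using assms(2)[OF that(1)] conf(8)[OF that(1)] that(2) by blast
  then have S: "symmetric_configuration (card Q) Q {x \<in> B. x \<subseteq> Q}"
    "symmetric_configuration (card (P - Q)) (P - Q) {x \<in> B. x \<subseteq> P - Q}"
    using assms by (intro symmetric_configuration_closed; blast)+
  have "0 < card Q" "0 < card (P - Q)"
    using assms conf(1) by (auto simp: card_gt_0_iff finite_subset)
  moreover have "B = {x \<in> B. x \<subseteq> Q} \<union> {x \<in> B. x \<subseteq> P - Q}"
    using assms(2) conf(8) by blast
  moreover have "Q \<inter> (P - Q) = {}" "P = Q \<union> (P - Q)" using assms(1) by blast+
  ultimately show ?thesis using S unfolding decomposable_def by blast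
qed

lemma level_3_near:
  assumes "s \<in> level 3 b" "x \<in> B" "s \<in> x"
  shows "x \<inter> b \<noteq> {}"
proof -
  have "card {x \<in> B. s \<in> x} = 3" "card (near s b) = 3"
    using assms(1) conf(9) unfolding level_def by auto
  moreover have "near s b \<subseteq> {x \<in> B. s \<in> x}" unfolding near_def by blast
  ultimately have "near s b = {x \<in> B. s \<in> x}"
    using conf(5) by (intro card_subset_eq) auto
  then show ?thesis using assms(2,3) unfolding near_def by blast
qed

text \<open>If \<open>p\<close> were missed, the three blocks through \<open>s\<close> would meet
  \<open>b\<close> in its two other points, and two of them would share both \<open>s\<close> and
  one of these.\<close>

lemma level_3_collinear:
  assumes s: "s \<in> level 3 b" and b: "b \<in> B" and p: "p \<in> b"
  obtains x where "x \<in> B" "s \<in> x" "p \<in> x"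
proof (rule ccontr)
  assume "\<not> thesis"
  then have none: "\<And>x. \<lbrakk>x \<in> B; s \<in> x\<rbrakk> \<Longrightarrow> p \<notin> x" using that by blast
  have sb: "s \<notin> b" "card (near s b) = 3" using s unfolding level_def by auto
  have "near s b = (\<Union>q\<in>b - {p}. {x \<in> near s b. q \<in> x})"
    using none unfolding near_def by blast
  also have "card \<dots> \<le> (\<Sum>q\<in>b - {p}. card {x \<in> near s b. q \<in> x})"
    using conf(7)[OF b] by (intro card_UN_le) simp
  also have "\<dots> \<le> (\<Sum>q\<in>b - {p}. 1)"
  proof (rule sum_mono)
    fix q assume "q \<in> b - {p}"
    then have "q \<noteq> s" using sb by blast
    then have "x = y" if "x \<in> near s b" "q \<in> x" "y \<in> near s b" "q \<in> y" for x y
      using that conf(10)[of x y q s] unfolding near_def by blast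
    then show "card {x \<in> near s b. q \<in> x} \<le> 1"
      using finite_near by (auto simp: card_le_Suc0_iff_eq)
  qed
  also have "\<dots> = 2" using conf(6)[OF b] p by simp
  finally show False using sb(2) by simp
qed

lemma near_level:
  assumes "s \<in> x" "x \<in> B" "x \<inter> b \<noteq> {}" "s \<notin> b"
  shows "s \<in> level 1 b \<or> s \<in> level 2 b \<or> s \<in> level 3 b"
proof -
  have sP: "s \<in> P" using assms(1,2) conf(8) by blast
  have "x \<in> near s b" using assms unfolding near_def by blast
  then have "card (near s b) \<noteq> 0" using finite_near by auto
  then have "card (near s b) \<in> {1, 2, 3}" using card_near_le[OF sP, of b] by auto
  then show ?thesis using sP assms(4) unfolding level_def by auto
qed

text \<open>The set \<open>b \<union> level 3 b\<close> has at most seven points and is closed: a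
  block touching it meets \<open>b\<close>, so its points off \<open>b\<close> have a nonzero level,
  which can only be 3.\<close>

lemma full_imp_decomposable:
  assumes b: "b \<in> B" and L: "card (level 3 b) = 4" "level 1 b = {}" "level 2 b = {}" and v: "v > 7"
  shows "decomposable P B"
proof (rule closed_imp_decomposable)
  let ?Q = "b \<union> level 3 b"
  show "?Q \<subseteq> P" using conf(8)[OF b] unfolding level_def by blast
  show "?Q \<noteq> {}" using L(1) by fastforce
  have "card ?Q \<le> 7" using card_Un_le[of b "level 3 b"] L(1) conf(6)[OF b] by simp
  then show "?Q \<noteq> P" using conf(2) v by auto
  show "x \<subseteq> ?Q" if x: "x \<in> B" "x \<inter> ?Q \<noteq> {}" for x
  proof -
    have "x \<inter> b \<noteq> {}" using x level_3_near by blast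
    then show ?thesis using near_level[OF _ x(1)] L(2,3) by blast
  qed
qed

lemma third_block:
  assumes "p \<in> P" "x \<in> B" "y \<in> B" "x \<noteq> y" "p \<in> x" "p \<in> y"
  obtains z where "z \<in> B" "z \<noteq> x" "z \<noteq> y" "{w \<in> B. p \<in> w} = {x, y, z}"
proof -
  have "card {w \<in> B. p \<in> w} = 3" using conf(9) assms(1) by simp
  moreover have "{x, y} \<subseteq> {w \<in> B. p \<in> w}" using assms by simp
  ultimately have "card ({w \<in> B. p \<in> w} - {x, y}) = 1"
    using assms(4) conf(5) by (subst card_Diff_subset) auto
  then obtain z where "{w \<in> B. p \<in> w} - {x, y} = {z}" by (auto simp: card_1_singleton_iff)
  then show ?thesis using that[of z] assms by blast
qed

text \<open>The blocks meeting \<open>b\<close> form, together with \<open>b\<close>, a Fano plane in which one point has been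
  split into the two points \<open>x\<close> (on two of these blocks) and \<open>y\<close> (on one of them). The block \<open>c\<close>
  through \<open>y\<close> has lost most of its triangles.\<close>

lemma low_neighbour:
  assumes b: "b \<in> B" and L: "card (level 3 b) = 3" "card (level 2 b) = 1" "card (level 1 b) = 1"
  obtains c where "c \<in> B" "card (corners c) \<le> 8" "2 \<le> card {y. (b, y) \<in> corners c}"
proof -
  obtain x y where x: "level 2 b = {x}" and y: "level 1 b = {y}"
    using L(2,3) by (auto simp: card_1_singleton_iff)
  have lev: "level k b \<subseteq> P - b" "j \<noteq> k \<Longrightarrow> level k b \<inter> level j b = {}" for j k
    unfolding level_def by auto
  have xy: "x \<in> P" "x \<notin> b" "x \<notin> level 3 b" "y \<in> P" "y \<notin> b" "y \<notin> level 3 b" "x \<noteq> y"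
    using x y lev(1)[of 1] lev(1)[of 2] lev(2)[of 3 2] lev(2)[of 3 1] lev(2)[of 1 2] by auto
  have "card (near y b) = 1" using y unfolding level_def by auto
  then obtain c where nc: "near y b = {c}" by (auto simp: card_1_singleton_iff)
  then have c: "c \<in> B" "y \<in> c" "c \<inter> b \<noteq> {}" unfolding near_def by auto
  then obtain p where p: "p \<in> c" "p \<in> b" by blast
  have cb: "c \<noteq> b" using c xy by blast
  have "p \<noteq> y" using p xy by blast
  then have "card (c - {p, y}) = 1" using conf(6,7)[OF c(1)] p c by (subst card_Diff_subset) auto
  then obtain s where "c - {p, y} = {s}" by (auto simp: card_1_singleton_iff)
  then have ceq: "c = {p, y, s}" and s: "s \<noteq> p" "s \<noteq> y" "s \<in> c" using p c by auto
  have sb: "s \<notin> b" using conf(10)[OF c(1) b p(1) s(3) p(2)] cb s(1) by blast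
  have pP: "p \<in> P" and sP: "s \<in> P" using c(1) p s conf(8) by auto
  obtain p2 where p2: "p2 \<in> B" "p2 \<noteq> b" "p2 \<noteq> c" "{w \<in> B. p \<in> w} = {b, c, p2}"
    using third_block[OF pP b c(1) cb[symmetric] p(2,1)] .
  then have pp2: "p \<in> p2" by blast
  \<comment> \<open>A level 3 point is joined to \<open>p\<close> by \<open>b\<close>,
    \<open>c\<close> or \<open>p2\<close>. It is off \<open>b\<close>, and \<open>c\<close> offers
    only \<open>s\<close>, since \<open>y\<close> has level 1; so \<open>p2\<close> remains.\<close>
  have sub: "level 3 b - {s} \<subseteq> p2 - {p}"
  proof
    fix m assume m: "m \<in> level 3 b - {s}"
    then obtain w where w: "w \<in> B" "m \<in> w" "p \<in> w" using level_3_collinear b p(2) by blast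
    then have "w \<in> {b, c, p2}" using p2(4) by blast
    moreover have "m \<notin> b" using m lev(1) by blast
    moreover from this have "m \<notin> c" using m xy p unfolding ceq by auto
    ultimately show "m \<in> p2 - {p}" using w \<open>m \<notin> b\<close> p(2) by auto
  qed
  have fin: "finite (level 3 b)" using lev(1) conf(1) by (meson finite_Diff finite_subset)
  have cp2: "card (p2 - {p}) = 2" using conf(6)[OF p2(1)] pp2 by simp
  \<comment> \<open>Otherwise all three points of level 3 would have to fit among the two points of
    \<open>p2 - {p}\<close>.\<close>
  have s3: "s \<in> level 3 b"
  proof (rule ccontr)
    assume "s \<notin> level 3 b"
    then have "level 3 b \<subseteq> p2 - {p}" using sub by simp
    then have "3 \<le> card (p2 - {p})" using L(1) conf(7)[OF p2(1)] card_mono by (metis finite_Diff)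
    then show False using cp2 by simp
  qed
  have sub_eq: "level 3 b - {s} = p2 - {p}"
    using sub conf(7)[OF p2(1)] cp2 s3 L(1) by (intro card_subset_eq) simp_all
  \<comment> \<open>No triangle through \<open>c\<close> has its vertex at \<open>y\<close>: a
    second block \<open>z\<close> through \<open>y\<close> misses \<open>b\<close>, whereas the
    third side \<open>w\<close> meets \<open>c\<close> in \<open>p\<close> or \<open>s\<close> and
    therefore meets \<open>b\<close>. Their common point has positive level, is not \<open>y\<close>
    and is not of level 3, so it is \<open>x\<close>; this is refuted in both cases.\<close>
  have key: False if zw: "(z, w) \<in> corners c" and yz: "y \<in> z" for z w
  proof -
    have z: "z \<in> B" "z \<noteq> c" and w: "w \<in> B" "w \<noteq> c" "c \<inter> w \<noteq> {}" and czw: "c \<inter> z \<inter> w = {}"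
      using zw unfolding corners_def by auto
    have zb: "z \<inter> b = {}" using nc z yz unfolding near_def by blast
    have "y \<notin> w" using czw yz c(2) by blast
    then have ps: "p \<in> w \<or> s \<in> w" using w(3) unfolding ceq by blast
    then have wb: "w \<inter> b \<noteq> {}" using p(2) level_3_near[OF s3 w(1)] by blast
    obtain g where g: "g \<in> z" "g \<in> w" using zw unfolding corners_def by blast
    have gb: "g \<notin> b" using zb g by blast
    have "g \<notin> level 3 b" using level_3_near[OF _ z(1) g(1)] zb by blast
    moreover have "g \<noteq> y" using g \<open>y \<notin> w\<close> by blast
    ultimately have gx: "g = x" using near_level[OF g(2) w(1) wb gb] x y by simp
    have wnb: "w \<noteq> b" using g(2) gb by blast
    show False
    proof (cases "p \<in> w")
      \<comment> \<open>Here \<open>w\<close> is \<open>p2\<close>, whose points other than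
        \<open>p\<close> all have level 3, unlike \<open>x\<close>.\<close>
      case True
      then have "w = p2" using p2(4) w wnb by blast
      then have "x \<in> p2 - {p}" using g(2) gx gb p(2) by blast
      then show False using sub_eq xy by blast
    next
      \<comment> \<open>Here \<open>w = {q, s, x}\<close>. The two level 3 points other than
        \<open>s\<close> must then be joined to \<open>q\<close> by its third block
        \<open>q2\<close>. They lie on \<open>p2\<close> too, so \<open>q2 = p2\<close>, and this
        block would meet \<open>b\<close> in both \<open>p\<close> and \<open>q\<close>.\<close>
      case False
      then have sw: "s \<in> w" using ps by blast
      obtain q where q: "q \<in> w" "q \<in> b" using wb by blast
      have qp: "q \<noteq> p" using False q by blast
      have sx: "s \<noteq> x" using s3 xy by blast
      have "q \<noteq> s" "q \<noteq> x" using q(2) sb xy(2) by blast+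
      then have "card {q, s, x} = 3" using sx by simp
      moreover have "{q, s, x} \<subseteq> w" using q sw g gx by simp
      ultimately have weq: "w = {q, s, x}"
        using conf(6,7)[OF w(1)] card_subset_eq by metis
      have qP: "q \<in> P" using q w(1) conf(8) by blast
      obtain q2 where q2: "q2 \<in> B" "q2 \<noteq> b" "{u \<in> B. q \<in> u} = {b, w, q2}"
        using third_block[OF qP b w(1) wnb[symmetric] q(2,1)] .
      have "level 3 b - {s} \<subseteq> q2"
      proof
        fix m assume m: "m \<in> level 3 b - {s}"
        then obtain u where u: "u \<in> B" "m \<in> u" "q \<in> u" using level_3_collinear b q(2) by blast
        then have "u \<in> {b, w, q2}" using q2(3) by blast
        moreover have "m \<notin> b" using m lev(1) by blast
        moreover from this have "m \<notin> w" using m xy q(2) unfolding weq by auto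
        ultimately show "m \<in> q2" using u by auto
      qed
      then have p2q2: "p2 - {p} \<subseteq> q2" using sub_eq by simp
      obtain m n where mn: "p2 - {p} = {m, n}" "m \<noteq> n" using cp2 by (meson card_2_iff)
      have "p2 = q2" by (rule conf(10)[OF p2(1) q2(1), of m n]) (use mn p2q2 in auto)
      then have "q \<in> p2" using q2(3) by blast
      then show False using conf(10)[OF p2(1) b pp2 _ p(2) q(2)] qp p2(2) by blast
    qed
  qed
  \<comment> \<open>With \<open>y\<close> excluded, a corner of \<open>c\<close> pairs one of the
    two other blocks through \<open>p\<close> with one of the two through \<open>s\<close>; in
    either order this gives 2 * 2 * 2 = 8 pairs.\<close>
  define Z where "Z q = {x \<in> B. q \<in> x} - {c}" for q
  have Z: "card (Z q) = 2" "finite (Z q)" if "q \<in> {p, s}" for q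
    using that conf(5,9) pP sP p(1) s(3) c(1) unfolding Z_def by auto
  have "corners c \<subseteq> Z p \<times> Z s \<union> Z s \<times> Z p"
  proof (rule subrelI)
    fix z w assume zw: "(z, w) \<in> corners c"
    then have ne: "c \<inter> z \<noteq> {}" "c \<inter> w \<noteq> {}" "c \<inter> z \<inter> w = {}" "z \<in> B" "w \<in> B" "z \<noteq> c" "w \<noteq> c"
      unfolding corners_def by auto
    have "y \<notin> z" "y \<notin> w" using key zw corners_swap by blast+
    then have "p \<in> z \<or> s \<in> z" "p \<in> w \<or> s \<in> w" using ne(1,2) unfolding ceq by blast+
    then show "(z, w) \<in> Z p \<times> Z s \<union> Z s \<times> Z p"
      using ne p(1) s(3) unfolding Z_def by blast
  qed
  then have "card (corners c) \<le> card (Z p \<times> Z s \<union> Z s \<times> Z p)"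
    using Z by (intro card_mono) auto
  also have "\<dots> \<le> card (Z p \<times> Z s) + card (Z s \<times> Z p)" by (rule card_Un_le)
  also have "\<dots> = 8" using Z by (simp add: card_cartesian_product)
  finally have c8: "card (corners c) \<le> 8" .
  \<comment> \<open>As \<open>s\<close> has level 3, two blocks besides \<open>c\<close> pass
    through it and meet \<open>b\<close>; each spans a triangle with \<open>b\<close> and
    \<open>c\<close>.\<close>
  have "near s b - {c} \<subseteq> {y. (b, y) \<in> corners c}"
  proof
    fix u assume u: "u \<in> near s b - {c}"
    have "c \<in> near s b" using c s unfolding near_def by blast
    then have "(c, u) \<in> corners b" using u sP sb unfolding corners_eq[OF b] by blast
    then show "u \<in> {y. (b, y) \<in> corners c}" using corners_commute[OF b] by blast
  qed
  moreover have "card (near s b - {c}) = 2"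
    using s3 c s unfolding level_def by (auto simp: near_def)
  moreover have "finite {y. (b, y) \<in> corners c}"
    by (rule finite_subset[OF _ conf(5)]) (auto simp: corners_def)
  ultimately have "2 \<le> card {y. (b, y) \<in> corners c}" by (metis card_mono)
  then show ?thesis using that c(1) c8 by blast
qed

text \<open>Discharging: each block with ten triangles gives its excess to a low neighbour \<open>c\<close>. Each of
  these donors uses two of the at most eight corners of \<open>c\<close>, so \<open>c\<close> receives at most four.\<close>

lemma sum_corners_le:
  assumes ndec: "\<not> decomposable P B" and v: "v > 7"
  shows "(\<Sum>b\<in>B. card (corners b)) \<le> 18 * v"
proof -
  define H where "H = {b \<in> B. card (corners b) > 18}"
  define M where "M = {c \<in> B. card (corners c) \<le> 8}"
  have fin: "finite H" "finite M" unfolding H_def M_def using conf(5) by simp_all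
  have H: "card (corners b) = 20 \<and>
      (\<exists>c. c \<in> M \<and> 2 \<le> card {y. (b, y) \<in> corners c})" if "b \<in> H" for b
  proof -
    have b: "b \<in> B" "card (corners b) > 18" using that unfolding H_def by auto
    show ?thesis
    proof (rule corners_cases[OF b(1)])
      assume "card (level 3 b) = 4" "level 1 b = {}" "level 2 b = {}"
      then show ?thesis using full_imp_decomposable[OF b(1)] v ndec by blast
    next
      assume L: "card (level 3 b) = 3" "card (level 2 b) = 1" "card (level 1 b) = 1"
        and 20: "card (corners b) = 20"
      from low_neighbour[OF b(1) L] show ?thesis using 20 unfolding M_def by blast
    qed (use b(2) in simp)
  qed
  then obtain \<phi> where \<phi>: "\<And>b. b \<in> H \<Longrightarrow> \<phi> b \<in> M"
    "\<And>b. b \<in> H \<Longrightarrow> 2 \<le> card {y. (b, y) \<in> corners (\<phi> b)}" by metis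
  have fibre: "card {b \<in> H. \<phi> b = c} \<le> 4" if "c \<in> M" for c
  proof -
    let ?F = "{b \<in> H. \<phi> b = c}"
    have finY: "finite {y. (b, y) \<in> corners c}" for b
      by (rule finite_subset[OF _ conf(5)]) (auto simp: corners_def)
    have "2 * card ?F = (\<Sum>b\<in>?F. 2)" by simp
    also have "\<dots> \<le> (\<Sum>b\<in>?F. card {y. (b, y) \<in> corners c})"
      using \<phi>(2) by (intro sum_mono) auto
    also have "\<dots> = card (SIGMA b:?F. {y. (b, y) \<in> corners c})"
      using fin finY by (intro card_SigmaI[symmetric]) auto
    also have "\<dots> \<le> card (corners c)" by (rule card_mono[OF finite_corners]) auto
    also have "\<dots> \<le> 8" using that unfolding M_def by simp
    finally show ?thesis by simp
  qed
  have "H = (\<Union>c\<in>M. {b \<in> H. \<phi> b = c})" using \<phi>(1) by blast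
  then have "card H \<le> (\<Sum>c\<in>M. card {b \<in> H. \<phi> b = c})"
    using card_UN_le[OF fin(2)] by metis
  also have "\<dots> \<le> (\<Sum>c\<in>M. 4)" using fibre by (rule sum_mono)
  finally have HM: "card H \<le> 4 * card M" by simp
  \<comment> \<open>A block in \<open>M\<close> lies at least 18 - 8 = 10 corners below the
    threshold, a block in \<open>H\<close> exactly 2 above it. The total excess
    \<open>2 * card H\<close> is at most \<open>8 * card M\<close>, hence covered by
    \<open>10 * card M\<close>.\<close>
  have "(\<Sum>b\<in>B. card (corners b) + (if b \<in> M then 10 else 0))
     \<le> (\<Sum>b\<in>B. 18 + (if b \<in> H then 2 else 0))"
  proof (rule sum_mono)
    fix b assume "b \<in> B"
    then show "card (corners b) + (if b \<in> M then 10 else 0) \<le> 18 + (if b \<in> H then 2 else 0)"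
      using H[of b] unfolding M_def H_def by auto
  qed
  moreover have "(\<Sum>b\<in>B. if b \<in> M then 10 else (0::nat)) = 10 * card M"
    "(\<Sum>b\<in>B. if b \<in> H then 2 else (0::nat)) = 2 * card H"
    using conf(5) unfolding M_def H_def by (simp_all add: sum.If_cases Int_def)
  ultimately have "(\<Sum>b\<in>B. card (corners b)) + 10 * card M \<le> 18 * card B + 2 * card H"
    by (simp add: sum.distrib)
  then show ?thesis using HM conf(4) by simp
qed

text \<open>The six orderings \<open>(x, y, z)\<close> of a triangle all have
  \<open>(y, z) \<in> corners x\<close>, and an ordering determines its triangle.\<close>

lemma six_num_triangles_le: "6 * num_triangles B \<le> (\<Sum>b\<in>B. card (corners b))"
proof -
  define W where "W S = {(x, y, z). S = {x, y, z} \<and> x \<noteq> y \<and> x \<noteq> z \<and> y \<noteq> z}" for S :: "'a set set"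
  let ?X = "SIGMA b:B. corners b"
  have finX: "finite ?X" using conf(5) finite_corners by blast
  have tri: "card (W S) = 6 \<and> W S \<subseteq> ?X" if S: "S \<in> triangles B" for S
  proof -
    obtain a b c d e f where dist: "distinct [a,b,c,d,e,f]" "S = {{a, b, f}, {a, c, e}, {b, c, d}}"
      and SB: "S \<subseteq> B"
      using S unfolding triangles_def mem_Collect_eq by (elim conjE exE) (rule that)
    define A C D where ACD: "A = {a, b, f}" "C = {a, c, e}" "D = {b, c, d}"
    have S: "S = {A, C, D}" unfolding ACD by (rule dist(2))
    have int: "A \<inter> C = {a}" "A \<inter> D = {b}" "C \<inter> D = {c}" unfolding ACD using dist(1) by auto
    have ne: "A \<noteq> C" "A \<noteq> D" "C \<noteq> D" unfolding ACD using dist(1) by auto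
    have abc: "A \<inter> C \<inter> D = {}" unfolding int(1) ACD(3) using dist(1) by auto
    have "W S = {(A,C,D), (A,D,C), (C,A,D), (C,D,A), (D,A,C), (D,C,A)}"
      (is "_ = ?L")
    proof
      show "W S \<subseteq> ?L"
      proof
        fix t assume "t \<in> W S"
        then obtain x y z where t: "t = (x, y, z)" "S = {x, y, z}" "x \<noteq> y" "x \<noteq> z" "y \<noteq> z"
          unfolding W_def by blast
        have "x \<in> S" "y \<in> S" "z \<in> S" unfolding t(2) by simp_all
        then show "t \<in> ?L"
          using t(3-5) unfolding t(1) S by (elim insertE emptyE) simp_all
      qed
      show "?L \<subseteq> W S" unfolding W_def S using ne by auto
    qed
    moreover have "card ?L = 6" using ne by simp
    moreover have "W S \<subseteq> ?X"
    proof
      fix t assume "t \<in> W S"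
      then obtain x y z where t: "t = (x, y, z)" "S = {x, y, z}" "x \<noteq> y" "x \<noteq> z" "y \<noteq> z"
        unfolding W_def by blast
      have "x \<inter> y \<inter> z = \<Inter> S" unfolding t(2) by auto
      also have "\<dots> = {}" unfolding S using abc by auto
      finally have "x \<inter> y \<inter> z = {}" .
      moreover have pair: "u \<inter> w \<noteq> {}" if "u \<in> S" "w \<in> S" "u \<noteq> w" for u w
        using that int unfolding S by (elim insertE emptyE) (auto simp: Int_commute)
      have "x \<inter> y \<noteq> {}" "x \<inter> z \<noteq> {}" "y \<inter> z \<noteq> {}"
        using pair t(2-5) by simp_all
      moreover have "x \<in> B" "y \<in> B" "z \<in> B" using SB t(2) by auto
      ultimately show "t \<in> ?X" using t(1,3-5) unfolding corners_def by simp
    qed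
    ultimately show ?thesis by simp
  qed
  have "6 * card (triangles B) = (\<Sum>S\<in>triangles B. card (W S))" using tri by simp
  also have "\<dots> = card (\<Union>S\<in>triangles B. W S)"
  proof (rule card_UN_disjoint[symmetric])
    show "\<forall>S\<in>triangles B. finite (W S)" using tri finX finite_subset by blast
    show "\<forall>S\<in>triangles B. \<forall>T\<in>triangles B. S \<noteq> T \<longrightarrow> W S \<inter> W T = {}" unfolding W_def by blast
  qed (use triangles_finite conf(5) in blast)
  also have "\<dots> \<le> card ?X" using tri finX by (intro card_mono) blast+
  also have "\<dots> = (\<Sum>b\<in>B. card (corners b))"
    using conf(5) finite_corners by (intro card_SigmaI) auto
  finally show ?thesis unfolding num_triangles_def .
qed

lemma num_triangles_le:
  assumes "\<not> decomposable P B" "v > 7"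
  shows "num_triangles B \<le> 3 * v"
  using six_num_triangles_le sum_corners_le[OF assms] by linarith

end

section \<open>Asymptotics\<close>

text \<open>A bound on \<open>Max\<close> requires a nonempty set; the chains provide a connected
  configuration for every \<open>v \<ge> 55\<close>, which is enough for a limit.\<close>

lemma max_triangles_le:
  assumes "v \<ge> 55"
  shows "max_triangles v \<le> 3 * v"
proof -
  let ?S = "{num_triangles B | (P :: nat set) B. connected_symmetric_configuration v P B}"
  obtain t where t: "extendable v t" using extendable_large[OF assms] by blast
  obtain P :: "nat set" and B where "connected_symmetric_configuration v P B"
    using extendable_imp_connected[OF t] .
  then have "num_triangles B \<in> ?S" by blast
  then have "?S \<noteq> {}" by (metis empty_iff)
  moreover have "k \<le> 3 * v" if "k \<in> ?S" for k
  proof -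
    from that obtain P :: "nat set" and B where k: "k = num_triangles B"
      and C: "connected_symmetric_configuration v P B" by blast
    interpret sym_conf v P B
      using C unfolding connected_symmetric_configuration_def by unfold_locales simp
    show ?thesis
      using num_triangles_le C assms unfolding k connected_symmetric_configuration_def by simp
  qed
  ultimately show ?thesis
    unfolding max_triangles_def using finite_num_triangles by simp
qed

lemma limsup_max_triangles_le:
  "limsup (\<lambda>v. ereal (real (max_triangles v) / real v)) \<le> 3"
proof (rule Limsup_bounded, rule eventually_sequentiallyI)
  fix v :: nat assume v: "55 \<le> v"
  then have "real (max_triangles v) \<le> 3 * real v" using max_triangles_le[OF v] by linarith
  then have "real (max_triangles v) / real v \<le> 3" using v by (simp add: divide_le_eq)
  then have "ereal (real (max_triangles v) / real v) \<le> ereal 3" by (simp only: ereal_less_eq)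
  then show "ereal (real (max_triangles v) / real v) \<le> 3" by simp
qed

theorem theorem3p2:
  "3 \<ge> limsup (\<lambda>v. ereal (real (max_triangles v) / real v)) \<and>
   limsup (\<lambda>v. ereal (real (max_triangles v) / real v))
     \<ge> liminf (\<lambda>v. ereal (real (max_triangles v) / real v)) \<and>
   liminf (\<lambda>v. ereal (real (max_triangles v) / real v)) \<ge> ereal (20 / 7)"
  using limsup_max_triangles_le liminf_max_triangles_ge
    Liminf_le_Limsup[of sequentially "\<lambda>v. ereal (real (max_triangles v) / real v)"] by simp

end
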